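(* Let $L$ be a finite semidistrim lattice and $x\in L$. Then $\mathsf{Row}_L(x)\le x$ if and only if $\mathcal{D}_L(x)$ is an independent dominating set of $\widetilde G_L$. Consequently, $|\{x\in L:\mathsf{Row}_L(x)\le x\}|=|\mathsf{Pop}^\downarrow_L(L)|=|\mathsf{Pop}^\uparrow_L(L)|=|\mathrm{Ind}^{\mathrm{dom}}(\widetilde G_L)|$.
   Context: All lattices are finite. For a lattice $L$, $\mathcal{J}_L$ (resp. $\mathcal{M}_L$) is the set of join-irreducible (resp. meet-irreducible) elements; for $j\in\mathcal{J}_L$, $j_*$ is the unique element covered by $j$, and for $m\in\mathcal{M}_L$, $m^*$ is the unique element covering $m$. Let $\mathcal{M}_L(j)=\max\{z\in L: j_*=j\wedge z\}$ and $\mathcal{J}_L(m)=\min\{z\in L: m^*=m\vee z\}$. A pairing on $L$ is a bijection $\kappa:\mathcal{J}_L\to\mathcal{M}_L$ with $\kappa(j)\in\mathcal{M}_L(j)$ for all $j$ and $\kappa^{-1}(m)\in\mathcal{J}_L(m)$ for all $m$; $L$ is uniquely paired if it has exactly one pairing, denoted $\kappa_L$. A prime pair is a pair $(j_0,m_0)$ with $L=[\hat0,m_0]\sqcup[j_0,\hat1]$. A uniquely paired lattice $L$ is compatibly dismantlable if $|L|=1$ or there is a prime pair $(j_0,m_0)$ such that: (i) $[j_0,\hat1]$ is compatibly dismantlable and $\alpha(j)=j_0\vee j$ defines a bijection $\{j\in\mathcal{J}_L: j_0\le\kappa_L(j)\}\to\mathcal{J}_{[j_0,\hat1]}$ with $\kappa_{[j_0,\hat1]}(\alpha(j))=\kappa_L(j)$;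 (ii) $[\hat0,m_0]$ is compatibly dismantlable and $\beta(m)=m_0\wedge m$ defines a bijection $\{m\in\mathcal{M}_L:\kappa_L^{-1}(m)\le m_0\}\to\mathcal{M}_{[\hat0,m_0]}$ with $\kappa_{[\hat0,m_0]}^{-1}(\beta(m))=\kappa_L^{-1}(m)$. The Galois graph $G_L$ is the directed graph on $\mathcal{J}_L$ with an edge $j\to j'$ iff $j\ne j'$ and $j\not\le\kappa_L(j')$; $\widetilde G_L$ is the undirected simple graph obtained by forgetting edge orientations. For $x\in L$ let $J_L(x)=\{j\in\mathcal{J}_L:j\le x\}$ and $M_L(x)=\{j\in\mathcal{J}_L:\kappa_L(j)\ge x\}$. For a compatibly dismantlable $L$, for every cover $x\lessdot y$ the set $M_L(x)\cap J_L(y)$ has exactly one element $j_{xy}$; set $\mathcal{D}_L(x)=\{j_{yx}:y\lessdot x\}$ and $\mathcal{U}_L(x)=\{j_{xy}:x\lessdot y\}$. $L$ is semidistrim if it is compatibly dismantlable and $\mathcal{D}_L(x)$, $\mathcal{U}_L(x)$ are independent sets (no two elements adjacent) of $G_L$ for all $x\in L$. For semidistrim $L$, the maps $\mathcal{D}_L$ and $\mathcal{U}_L$ are bijections from $L$ to the set of independent sets of $G_L$, and rowmotion $\mathsf{Row}_L:L\to L$ is the bijection defined by $\mathcal{U}_L(\mathsf{Row}_L(x))=\mathcal{D}_L(x)$. $\mathsf{Pop}^\downarrow_L(x)=x\wedge\bigwedge\{y:y\lessdot x\}$ and $\mathsf{Pop}^\uparrow_L(x)=x\vee\bigvee\{y:x\lessdot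 y\}$, with images $\mathsf{Pop}^\downarrow_L(L)$, $\mathsf{Pop}^\uparrow_L(L)$. In an undirected graph, a set $I$ of vertices is dominating if every vertex is in $I$ or adjacent to a vertex of $I$; $\mathrm{Ind}^{\mathrm{dom}}(G)$ is the set of independent dominating sets of $G$. *)

theory Defs
  imports "HOL-Library.FuncSet" "Graph_Theory.Digraph_Component"
begin

text \<open>
  A finite lattice is a nonempty finite set \<open>L\<close> of elements of an ambient type of class
  \<^class>\<open>lattice\<close>, closed under the ambient meet and join (taking \<open>L = UNIV\<close> in a finite type
  gives every nonempty finite lattice). All notions are relative to \<open>L\<close>, so that they apply
  equally to the intervals of \<open>L\<close>.
\<close>

definition finite_lattice :: "'a::lattice set \<Rightarrow> bool" where
  "finite_lattice L \<longleftrightarrow>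
     finite L \<and> L \<noteq> {} \<and> (\<forall>x\<in>L. \<forall>y\<in>L. inf x y \<in> L \<and> sup x y \<in> L)"

definition covers :: "'a::lattice set \<Rightarrow> 'a \<Rightarrow> 'a \<Rightarrow> bool" where
  \<comment> \<open>\<open>covers L x y\<close> means that \<open>y\<close> covers \<open>x\<close> in \<open>L\<close>\<close>
  "covers L x y \<longleftrightarrow> x \<in> L \<and> y \<in> L \<and> x < y \<and> \<not> (\<exists>z\<in>L. x < z \<and> z < y)"

definition join_irr :: "'a::lattice set \<Rightarrow> 'a set" where
  "join_irr L = {j \<in> L. \<exists>!y. covers L y j}"

definition meet_irr :: "'a::lattice set \<Rightarrow> 'a set" where
  "meet_irr L = {m \<in> L. \<exists>!y. covers L m y}"

definition lower_cover :: "'a::lattice set \<Rightarrow> 'a \<Rightarrow> 'a" where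
  "lower_cover L j = (THE y. covers L y j)"

definition upper_cover :: "'a::lattice set \<Rightarrow> 'a \<Rightarrow> 'a" where
  "upper_cover L m = (THE y. covers L m y)"

definition maximal_elems :: "'a::order set \<Rightarrow> 'a set" where
  "maximal_elems Z = {z \<in> Z. \<not> (\<exists>w\<in>Z. z < w)}"

definition minimal_elems :: "'a::order set \<Rightarrow> 'a set" where
  "minimal_elems Z = {z \<in> Z. \<not> (\<exists>w\<in>Z. w < z)}"

definition max_mates :: "'a::lattice set \<Rightarrow> 'a \<Rightarrow> 'a set" where
  \<comment> \<open>\<open>\<M>\<^sub>L(j)\<close>\<close>
  "max_mates L j = maximal_elems {z \<in> L. lower_cover L j = inf j z}"

definition min_mates :: "'a::lattice set \<Rightarrow> 'a \<Rightarrow> 'a set" where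
  \<comment> \<open>\<open>\<J>\<^sub>L(m)\<close>\<close>
  "min_mates L m = minimal_elems {z \<in> L. upper_cover L m = sup m z}"

text \<open>Pairings are extensional functions, so that uniqueness means uniqueness on
  \<open>join_irr L\<close>.\<close>

definition pairing :: "'a::lattice set \<Rightarrow> ('a \<Rightarrow> 'a) \<Rightarrow> bool" where
  "pairing L \<kappa> \<longleftrightarrow>
     \<kappa> \<in> extensional (join_irr L) \<and>
     bij_betw \<kappa> (join_irr L) (meet_irr L) \<and>
     (\<forall>j\<in>join_irr L. \<kappa> j \<in> max_mates L j) \<and>
     (\<forall>m\<in>meet_irr L. the_inv_into (join_irr L) \<kappa> m \<in> min_mates L m)"

definition uniquely_paired :: "'a::lattice set \<Rightarrow> bool" where
  "uniquely_paired L \<longleftrightarrow> (\<exists>!\<kappa>. pairing L \<kappa>)"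

definition kappa :: "'a::lattice set \<Rightarrow> 'a \<Rightarrow> 'a" where
  "kappa L = (THE \<kappa>. pairing L \<kappa>)"

definition kappa_inv :: "'a::lattice set \<Rightarrow> 'a \<Rightarrow> 'a" where
  "kappa_inv L = the_inv_into (join_irr L) (kappa L)"

definition up_interval :: "'a::lattice set \<Rightarrow> 'a \<Rightarrow> 'a set" where
  "up_interval L a = {z \<in> L. a \<le> z}"

definition down_interval :: "'a::lattice set \<Rightarrow> 'a \<Rightarrow> 'a set" where
  "down_interval L b = {z \<in> L. z \<le> b}"

definition prime_pair :: "'a::lattice set \<Rightarrow> 'a \<Rightarrow> 'a \<Rightarrow> bool" where
  "prime_pair L j\<^sub>0 m\<^sub>0 \<longleftrightarrow>
     j\<^sub>0 \<in> L \<and> m\<^sub>0 \<in> L \<and>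
     L = down_interval L m\<^sub>0 \<union> up_interval L j\<^sub>0 \<and>
     down_interval L m\<^sub>0 \<inter> up_interval L j\<^sub>0 = {}"

inductive compatibly_dismantlable :: "'a::lattice set \<Rightarrow> bool" where
  singleton:
    "uniquely_paired L \<Longrightarrow> card L = 1 \<Longrightarrow> compatibly_dismantlable L"
| dismantle:
    "uniquely_paired L \<Longrightarrow>
     prime_pair L j\<^sub>0 m\<^sub>0 \<Longrightarrow>
     compatibly_dismantlable (up_interval L j\<^sub>0) \<Longrightarrow>
     bij_betw (\<lambda>j. sup j\<^sub>0 j) {j \<in> join_irr L. j\<^sub>0 \<le> kappa L j}
       (join_irr (up_interval L j\<^sub>0)) \<Longrightarrow>
     \<forall>j\<in>{j \<in> join_irr L. j\<^sub>0 \<le> kappa L j}.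
       kappa (up_interval L j\<^sub>0) (sup j\<^sub>0 j) = kappa L j \<Longrightarrow>
     compatibly_dismantlable (down_interval L m\<^sub>0) \<Longrightarrow>
     bij_betw (\<lambda>m. inf m\<^sub>0 m) {m \<in> meet_irr L. kappa_inv L m \<le> m\<^sub>0}
       (meet_irr (down_interval L m\<^sub>0)) \<Longrightarrow>
     \<forall>m\<in>{m \<in> meet_irr L. kappa_inv L m \<le> m\<^sub>0}.
       kappa_inv (down_interval L m\<^sub>0) (inf m\<^sub>0 m) = kappa_inv L m \<Longrightarrow>
     compatibly_dismantlable L"

definition galois_graph :: "'a::lattice set \<Rightarrow> 'a pair_pre_digraph" where
  "galois_graph L =
     \<lparr> pverts = join_irr L,
       parcs = {(j, j'). j \<in> join_irr L \<and> j' \<in> join_irr L \<and> j \<noteq> j' \<and> \<not> j \<le> kappa L j'} \<rparr>"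

text \<open>An undirected simple graph is represented by its symmetric digraph.\<close>

definition undirected_galois_graph :: "'a::lattice set \<Rightarrow> 'a pair_pre_digraph" where
  "undirected_galois_graph L = mk_symmetric (with_proj (galois_graph L))"

definition independent_set :: "'v pair_pre_digraph \<Rightarrow> 'v set \<Rightarrow> bool" where
  "independent_set G I \<longleftrightarrow> I \<subseteq> pverts G \<and> (\<forall>u\<in>I. \<forall>v\<in>I. (u, v) \<notin> parcs G)"

definition dominating_set :: "'v pair_pre_digraph \<Rightarrow> 'v set \<Rightarrow> bool" where
  "dominating_set G I \<longleftrightarrow>
     I \<subseteq> pverts G \<and> (\<forall>v\<in>pverts G. v \<in> I \<or> (\<exists>u\<in>I. (v, u) \<in> parcs G))"

definition Ind_dom :: "'v pair_pre_digraph \<Rightarrow> 'v set set" where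
  "Ind_dom G = {I. independent_set G I \<and> dominating_set G I}"

definition J_set :: "'a::lattice set \<Rightarrow> 'a \<Rightarrow> 'a set" where
  "J_set L x = {j \<in> join_irr L. j \<le> x}"

definition M_set :: "'a::lattice set \<Rightarrow> 'a \<Rightarrow> 'a set" where
  "M_set L x = {j \<in> join_irr L. x \<le> kappa L j}"

definition edge_label :: "'a::lattice set \<Rightarrow> 'a \<Rightarrow> 'a \<Rightarrow> 'a" where
  \<comment> \<open>\<open>j\<^bsub>xy\<^esub>\<close> for a cover \<open>x \<lessdot> y\<close>\<close>
  "edge_label L x y = (THE j. j \<in> M_set L x \<inter> J_set L y)"

definition down_labels :: "'a::lattice set \<Rightarrow> 'a \<Rightarrow> 'a set" where
  "down_labels L x = {edge_label L y x | y. covers L y x}"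

definition up_labels :: "'a::lattice set \<Rightarrow> 'a \<Rightarrow> 'a set" where
  "up_labels L x = {edge_label L x y | y. covers L x y}"

definition semidistrim :: "'a::lattice set \<Rightarrow> bool" where
  "semidistrim L \<longleftrightarrow>
     compatibly_dismantlable L \<and>
     (\<forall>x\<in>L. independent_set (galois_graph L) (down_labels L x) \<and>
            independent_set (galois_graph L) (up_labels L x))"

text \<open>\<open>Row L x\<close> is the unique \<open>y \<in> L\<close> with \<open>up_labels L y = down_labels L x\<close>.\<close>

definition Row :: "'a::lattice set \<Rightarrow> 'a \<Rightarrow> 'a" where
  "Row L x = the_inv_into L (up_labels L) (down_labels L x)"

definition Pop_down :: "'a::lattice set \<Rightarrow> 'a \<Rightarrow> 'a" where
  "Pop_down L x = Inf_fin (insert x {y. covers L y x})"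

definition Pop_up :: "'a::lattice set \<Rightarrow> 'a \<Rightarrow> 'a" where
  "Pop_up L x = Sup_fin (insert x {y. covers L x y})"

end

theory Submission
  imports Defs
begin

text \<open>
  For \<open>u \<le> v\<close> the down-labels lying in \<open>M(u)\<close> give a bijection from \<open>[u, v]\<close> to the independent
  subsets of \<open>M(u) \<inter> J(v)\<close>, by induction along the dismantling: if the prime pair
  \<open>(j\<^sub>0, m\<^sub>0)\<close> splits the interval, then every independent set that does not lie below \<open>m\<^sub>0\<close>
  comes, up to \<open>j\<^sub>0\<close>, from the part above \<open>j\<^sub>0\<close>. By counting, the same holds for up-labels.
  Applied to \<open>[z, x]\<close> with \<open>z = Pop_down(x)\<close>, this gives \<open>D(x) \<subseteq> U(z)\<close>. As independent dominating
  sets are the maximal independent sets, \<open>D(x)\<close> dominating forces \<open>U(z) = D(x)\<close>, hence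
  \<open>Row(x) = Pop_down(x) \<le> x\<close>. Conversely a vertex \<open>j\<close> outside \<open>D(x)\<close> and not adjacent to it satisfies
  \<open>j \<le> Row(x)\<close> and \<open>x \<le> \<kappa>(j)\<close>, which excludes \<open>Row(x) \<le> x\<close>. The same two steps identify the images
  of \<open>Pop_down\<close> and \<open>Pop_up\<close> with the elements whose up-labels, respectively down-labels, dominate.
\<close>

section \<open>Covers in finite lattices\<close>

lemma finite_lattice_inf: "finite_lattice L \<Longrightarrow> x \<in> L \<Longrightarrow> y \<in> L \<Longrightarrow> inf x y \<in> L"
  by (auto simp: finite_lattice_def)

lemma finite_lattice_sup: "finite_lattice L \<Longrightarrow> x \<in> L \<Longrightarrow> y \<in> L \<Longrightarrow> sup x y \<in> L"
  by (auto simp: finite_lattice_def)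

lemma finite_lattice_Inf_fin:
  assumes "finite_lattice L" "A \<subseteq> L" "A \<noteq> {}"
  shows "Inf_fin A \<in> L"
proof -
  have "finite A" using assms by (auto simp: finite_lattice_def intro: finite_subset)
  then show ?thesis
    using assms(3,2) by (induction rule: finite_ne_induct) (auto simp: finite_lattice_inf[OF assms(1)])
qed

lemma finite_lattice_Sup_fin:
  assumes "finite_lattice L" "A \<subseteq> L" "A \<noteq> {}"
  shows "Sup_fin A \<in> L"
proof -
  have "finite A" using assms by (auto simp: finite_lattice_def intro: finite_subset)
  then show ?thesis
    using assms(3,2) by (induction rule: finite_ne_induct) (auto simp: finite_lattice_sup[OF assms(1)])
qed

lemma finite_lattice_up_interval:
  "finite_lattice L \<Longrightarrow> a \<in> L \<Longrightarrow> finite_lattice (up_interval L a)"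
  by (auto simp: finite_lattice_def up_interval_def le_supI1)

lemma finite_lattice_down_interval:
  "finite_lattice L \<Longrightarrow> a \<in> L \<Longrightarrow> finite_lattice (down_interval L a)"
  by (auto simp: finite_lattice_def down_interval_def le_infI1)

lemma ex_lower_cover_above:
  assumes "finite L" "a \<in> L" "b \<in> L" "a < b"
  shows "\<exists>y. covers L y b \<and> a \<le> y"
proof -
  let ?S = "{z \<in> L. a \<le> z \<and> z < b}"
  have "finite ?S" "?S \<noteq> {}" using assms by auto
  then obtain m where m: "m \<in> ?S" "\<forall>z\<in>?S. m \<le> z \<longrightarrow> m = z"
    using finite_has_maximal by blast
  have "covers L m b"
    unfolding covers_def using m assms by (auto dest: less_imp_le order.trans)
  with m show ?thesis by blast
qed

lemma ex_upper_cover_below: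
  assumes "finite L" "a \<in> L" "b \<in> L" "a < b"
  shows "\<exists>y. covers L a y \<and> y \<le> b"
proof -
  let ?S = "{z \<in> L. a < z \<and> z \<le> b}"
  have "finite ?S" "?S \<noteq> {}" using assms by auto
  then obtain m where m: "m \<in> ?S" "\<forall>z\<in>?S. z \<le> m \<longrightarrow> m = z"
    using finite_has_minimal by blast
  have "covers L a m"
    unfolding covers_def using m assms by (auto dest: less_imp_le order.trans)
  with m show ?thesis by blast
qed

lemma covers_lower_cover: "j \<in> join_irr L \<Longrightarrow> covers L (lower_cover L j) j"
  unfolding join_irr_def lower_cover_def by (auto intro: theI')

lemma le_lower_cover:
  assumes "finite L" "j \<in> join_irr L" "a \<in> L" "a < j"
  shows "a \<le> lower_cover L j"
proof -
  have "j \<in> L" using assms by (simp add: join_irr_def)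
  then obtain y where y: "covers L y j" "a \<le> y"
    using ex_lower_cover_above assms by blast
  then have "y = lower_cover L j"
    using covers_lower_cover[OF assms(2)] assms(2) by (auto simp: join_irr_def)
  with y show ?thesis by simp
qed

lemma covers_down_interval:
  "y \<le> b \<Longrightarrow> covers (down_interval L b) x y \<longleftrightarrow> covers L x y"
  unfolding covers_def down_interval_def by (auto dest: less_imp_le order.trans)

text \<open>Lower covers of elements of a lower interval stay inside it, so there only the pairing
  has to be adjusted. In an upper interval the join-irreducibles change as well.\<close>

lemma join_irr_down_interval: "join_irr (down_interval L b) = {j \<in> join_irr L. j \<le> b}"
proof -
  have "j \<in> down_interval L b \<longleftrightarrow> j \<le> b \<and> j \<in> L" for j
    by (auto simp: down_interval_def)
  then show ?thesis
    by (simp add: join_irr_def covers_down_interval conj_ac cong: conj_cong)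
qed

section \<open>The pairing\<close>

lemma pairing_kappa: "uniquely_paired L \<Longrightarrow> pairing L (kappa L)"
  unfolding uniquely_paired_def kappa_def by (rule theI'[where P = "pairing L"])

lemma kappa_mem:
  assumes "uniquely_paired L" "j \<in> join_irr L"
  shows "kappa L j \<in> meet_irr L" "kappa L j \<in> L"
proof -
  show "kappa L j \<in> meet_irr L"
    using pairing_kappa[OF assms(1)] assms(2) by (auto simp: pairing_def dest: bij_betwE)
  then show "kappa L j \<in> L" by (simp add: meet_irr_def)
qed

lemma kappa_in_max_mates:
  "uniquely_paired L \<Longrightarrow> j \<in> join_irr L \<Longrightarrow> kappa L j \<in> max_mates L j"
  using pairing_kappa by (auto simp: pairing_def)

lemma inf_kappa:
  "uniquely_paired L \<Longrightarrow> j \<in> join_irr L \<Longrightarrow> inf j (kappa L j) = lower_cover L j"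
  using kappa_in_max_mates by (fastforce simp: max_mates_def maximal_elems_def)

lemma not_le_kappa:
  assumes "uniquely_paired L" "j \<in> join_irr L"
  shows "\<not> j \<le> kappa L j"
proof
  assume "j \<le> kappa L j"
  then have "lower_cover L j = j" using inf_kappa[OF assms] by (simp add: inf_absorb1)
  then show False using covers_lower_cover[OF assms(2)] by (simp add: covers_def)
qed

lemma kappa_inv_kappa:
  "uniquely_paired L \<Longrightarrow> j \<in> join_irr L \<Longrightarrow> kappa_inv L (kappa L j) = j"
  using pairing_kappa
  by (auto simp: pairing_def kappa_inv_def bij_betw_def intro: the_inv_into_f_f)

lemma kappa_kappa_inv:
  "uniquely_paired L \<Longrightarrow> m \<in> meet_irr L \<Longrightarrow> kappa L (kappa_inv L m) = m"
  using pairing_kappa f_the_inv_into_f_bij_betw by (fastforce simp: pairing_def kappa_inv_def)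

lemma compatibly_dismantlable_uniquely_paired:
  "compatibly_dismantlable L \<Longrightarrow> uniquely_paired L"
  by (auto elim: compatibly_dismantlable.cases)

lemma prime_pair_cases:
  "prime_pair L j\<^sub>0 m\<^sub>0 \<Longrightarrow> x \<in> L \<Longrightarrow> j\<^sub>0 \<le> x \<or> x \<le> m\<^sub>0"
  by (auto simp: prime_pair_def up_interval_def down_interval_def)

lemma prime_pair_not_le: "prime_pair L j\<^sub>0 m\<^sub>0 \<Longrightarrow> \<not> j\<^sub>0 \<le> m\<^sub>0"
  by (auto simp: prime_pair_def up_interval_def down_interval_def)

text \<open>Whatever lies strictly below \<open>j\<^sub>0\<close> is not above
  \<open>j\<^sub>0\<close>, hence lies below \<open>m\<^sub>0\<close>. So
  \<open>inf j\<^sub>0 m\<^sub>0\<close> is the largest element strictly below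
  \<open>j\<^sub>0\<close>.\<close>

lemma prime_pair_join_irr:
  assumes "finite_lattice L" "prime_pair L j\<^sub>0 m\<^sub>0"
  shows "j\<^sub>0 \<in> join_irr L" "lower_cover L j\<^sub>0 = inf j\<^sub>0 m\<^sub>0"
proof -
  have mem: "j\<^sub>0 \<in> L" "m\<^sub>0 \<in> L" using assms by (auto simp: prime_pair_def)
  have lt: "inf j\<^sub>0 m\<^sub>0 < j\<^sub>0"
    using prime_pair_not_le[OF assms(2)] by (simp add: less_le_not_le)
  have below: "z \<le> inf j\<^sub>0 m\<^sub>0" if "z \<in> L" "z < j\<^sub>0" for z
    using prime_pair_cases[OF assms(2) that(1)] that by auto
  have iff: "covers L y j\<^sub>0 \<longleftrightarrow> y = inf j\<^sub>0 m\<^sub>0" for y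
  proof
    assume y: "covers L y j\<^sub>0"
    then have "y \<le> inf j\<^sub>0 m\<^sub>0" using below by (auto simp: covers_def)
    with y lt show "y = inf j\<^sub>0 m\<^sub>0"
      using finite_lattice_inf[OF assms(1) mem] by (auto simp: covers_def order.order_iff_strict)
  next
    assume "y = inf j\<^sub>0 m\<^sub>0"
    then show "covers L y j\<^sub>0"
      using mem lt below finite_lattice_inf[OF assms(1) mem]
      by (auto simp: covers_def less_le_not_le)
  qed
  then show "j\<^sub>0 \<in> join_irr L" "lower_cover L j\<^sub>0 = inf j\<^sub>0 m\<^sub>0"
    using mem by (auto simp: join_irr_def lower_cover_def)
qed

text \<open>As \<open>kappa L j\<^sub>0\<close> is not above \<open>j\<^sub>0\<close>, it lies below
  \<open>m\<^sub>0\<close>. Since \<open>m\<^sub>0\<close> also meets \<open>j\<^sub>0\<close> in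
  its lower cover, maximality of the mate forces equality.\<close>

lemma prime_pair_kappa:
  assumes "finite_lattice L" "uniquely_paired L" "prime_pair L j\<^sub>0 m\<^sub>0"
  shows "kappa L j\<^sub>0 = m\<^sub>0"
proof -
  note j0 = prime_pair_join_irr[OF assms(1,3)]
  have m0: "m\<^sub>0 \<in> L" using assms by (simp add: prime_pair_def)
  have "kappa L j\<^sub>0 \<le> m\<^sub>0"
    using prime_pair_cases[OF assms(3) kappa_mem(2)[OF assms(2) j0(1)]]
      not_le_kappa[OF assms(2) j0(1)] by blast
  moreover have "\<not> kappa L j\<^sub>0 < m\<^sub>0"
    using kappa_in_max_mates[OF assms(2) j0(1)] m0 j0(2)
    by (auto simp: max_mates_def maximal_elems_def)
  ultimately show ?thesis by (simp add: order.order_iff_strict)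
qed

text \<open>A \<open>j\<close> that is neither \<open>j\<^sub>0\<close> nor below
  \<open>m\<^sub>0\<close> lies strictly above \<open>j\<^sub>0\<close>. Then
  \<open>j\<^sub>0\<close> lies below the lower cover of \<open>j\<close>, which lies below
  \<open>kappa L j\<close>. This supplies the trichotomy of labels required by
  \<open>splits.step\<close>.\<close>

lemma prime_pair_types:
  assumes "finite_lattice L" "uniquely_paired L" "prime_pair L j\<^sub>0 m\<^sub>0" "j \<in> join_irr L"
  shows "j \<le> m\<^sub>0 \<or> j\<^sub>0 \<le> kappa L j \<or> j = j\<^sub>0"
proof (rule ccontr)
  assume neg: "\<not> ?thesis"
  have "j \<in> L" "j\<^sub>0 \<in> L" "finite L"
    using assms by (auto simp: join_irr_def prime_pair_def finite_lattice_def)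
  moreover from this neg have "j\<^sub>0 < j"
    using prime_pair_cases[OF assms(3)] by (auto simp: order.order_iff_strict)
  ultimately have "j\<^sub>0 \<le> lower_cover L j" using le_lower_cover assms(4) by blast
  with neg inf_kappa[OF assms(2,4)] show False by (metis le_inf_iff)
qed

section \<open>Recursive splitting of intervals\<close>

text \<open>Dismantling a sublattice is expressed with the join-irreducibles and the pairing of the
  ambient lattice, so that nothing has to be transferred between intervals afterwards.\<close>

inductive splits :: "'a::lattice set \<Rightarrow> 'a set \<Rightarrow> ('a \<Rightarrow> 'a) \<Rightarrow> 'a \<Rightarrow> 'a \<Rightarrow> bool"
  for L V \<kappa> where
  refl: "splits L V \<kappa> u u"
| step: "u \<le> v \<Longrightarrow> j\<^sub>0 \<in> V \<Longrightarrow> u \<le> \<kappa> j\<^sub>0 \<Longrightarrow> j\<^sub>0 \<le> v \<Longrightarrow>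
    (\<And>x. x \<in> L \<Longrightarrow> u \<le> x \<Longrightarrow> x \<le> v \<Longrightarrow> j\<^sub>0 \<le> x \<or> x \<le> \<kappa> j\<^sub>0) \<Longrightarrow>
    (\<And>j. j \<in> V \<Longrightarrow> u \<le> \<kappa> j \<Longrightarrow> j \<le> v \<Longrightarrow> j \<le> \<kappa> j\<^sub>0 \<or> j\<^sub>0 \<le> \<kappa> j \<or> j = j\<^sub>0) \<Longrightarrow>
    splits L V \<kappa> (sup u j\<^sub>0) v \<Longrightarrow> splits L V \<kappa> u (inf v (\<kappa> j\<^sub>0)) \<Longrightarrow> splits L V \<kappa> u v"

text \<open>Each join-irreducible \<open>j1\<close> of the upper interval is
  \<open>sup j\<^sub>0 j\<close> for some \<open>j\<close> of \<open>L\<close> with the same mate.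
  For elements above \<open>j\<^sub>0\<close>, being above \<open>j1\<close> and being above
  \<open>j\<close> are the same condition, so each splitting step can be replayed in
  \<open>L\<close> with \<open>j\<close> in place of \<open>j1\<close>.\<close>

lemma splits_up_interval:
  assumes "splits (up_interval L j\<^sub>0) (join_irr (up_interval L j\<^sub>0)) (kappa (up_interval L j\<^sub>0)) u v"
    and "j\<^sub>0 \<le> u"
    and bij: "bij_betw (\<lambda>j. sup j\<^sub>0 j) {j \<in> join_irr L. j\<^sub>0 \<le> kappa L j}
       (join_irr (up_interval L j\<^sub>0))"
    and kap: "\<forall>j\<in>{j \<in> join_irr L. j\<^sub>0 \<le> kappa L j}.
       kappa (up_interval L j\<^sub>0) (sup j\<^sub>0 j) = kappa L j"
  shows "splits L (join_irr L) (kappa L) u v"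
  using assms(1,2)
proof (induction rule: splits.induct)
  case (refl u)
  show ?case by (rule splits.refl)
next
  case (step u v j1)
  obtain j where j: "j \<in> join_irr L" "j\<^sub>0 \<le> kappa L j" "j1 = sup j\<^sub>0 j"
    using step.hyps(2) bij by (auto simp: bij_betw_def)
  have kj: "kappa (up_interval L j\<^sub>0) j1 = kappa L j" using kap j by simp
  have supj: "sup u j1 = sup u j"
    using j(3) step.prems by (simp add: sup_absorb1 flip: sup_assoc)
  show ?case
  proof (rule splits.step[where j\<^sub>0 = j])
    show "u \<le> v" "j \<in> join_irr L" "u \<le> kappa L j" "j \<le> v"
      using step.hyps j kj by auto
    show "splits L (join_irr L) (kappa L) (sup u j) v"
      using step.IH(1) step.prems supj by (simp add: le_supI1)
    show "splits L (join_irr L) (kappa L) u (inf v (kappa L j))"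
      using step.IH(2) step.prems kj by simp
    show "j \<le> x \<or> x \<le> kappa L j" if "x \<in> L" "u \<le> x" "x \<le> v" for x
      using step.hyps(5)[of x] that step.prems j(3) kj by (auto simp: up_interval_def)
    \<comment> \<open>The trichotomy of the upper interval is applied to
      \<open>sup j\<^sub>0 j'\<close>. Injectivity of the correspondence turns
      \<open>sup j\<^sub>0 j' = j1\<close> back into \<open>j' = j\<close>.\<close>
    show "j' \<le> kappa L j \<or> j \<le> kappa L j' \<or> j' = j"
      if "j' \<in> join_irr L" "u \<le> kappa L j'" "j' \<le> v" for j'
    proof -
      have j': "j' \<in> {j \<in> join_irr L. j\<^sub>0 \<le> kappa L j}" using that step.prems by auto
      then have "sup j\<^sub>0 j' \<in> join_irr (up_interval L j\<^sub>0)" "kappa (up_interval L j\<^sub>0) (sup j\<^sub>0 j') = kappa L j'"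
        using bij kap by (auto simp: bij_betw_def)
      moreover have "sup j\<^sub>0 j' \<le> v" using that step.prems step.hyps(1) by auto
      ultimately have "sup j\<^sub>0 j' \<le> kappa L j \<or> j1 \<le> kappa L j' \<or> sup j\<^sub>0 j' = j1"
        using step.hyps(6)[of "sup j\<^sub>0 j'"] that kj by auto
      then show ?thesis
        using j j' bij by (auto simp: bij_betw_def dest: inj_onD)
    qed
  qed
qed

text \<open>All elements compared with a mate lie below \<open>v\<close>, hence below
  \<open>m\<^sub>0\<close>, so cutting \<open>kappa L j\<close> down to
  \<open>inf m\<^sub>0 (kappa L j)\<close> changes none of the comparisons.\<close>

lemma splits_down_interval:
  assumes "splits (down_interval L m\<^sub>0) (join_irr (down_interval L m\<^sub>0)) (kappa (down_interval L m\<^sub>0)) u v"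
    and "v \<le> m\<^sub>0"
    and kap: "\<And>j. j \<in> join_irr L \<Longrightarrow> j \<le> m\<^sub>0 \<Longrightarrow> kappa (down_interval L m\<^sub>0) j = inf m\<^sub>0 (kappa L j)"
  shows "splits L (join_irr L) (kappa L) u v"
  using assms(1,2)
proof (induction rule: splits.induct)
  case (refl u)
  show ?case by (rule splits.refl)
next
  case (step u v j)
  have j: "j \<in> join_irr L" "j \<le> m\<^sub>0"
    using step.hyps(2) by (auto simp: join_irr_down_interval)
  note kj = kap[OF j]
  show ?case
  proof (rule splits.step[where j\<^sub>0 = j])
    show "u \<le> v" "j \<in> join_irr L" "u \<le> kappa L j" "j \<le> v"
      using step.hyps j kj by auto
    show "splits L (join_irr L) (kappa L) (sup u j) v"
      using step.IH(1) step.prems by simp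
    have "inf v (kappa (down_interval L m\<^sub>0) j) = inf v (kappa L j)"
      using step.prems kj by (simp add: inf_absorb1 flip: inf_assoc)
    then show "splits L (join_irr L) (kappa L) u (inf v (kappa L j))"
      using step.IH(2) step.prems by (simp add: le_infI1)
    show "j \<le> x \<or> x \<le> kappa L j" if "x \<in> L" "u \<le> x" "x \<le> v" for x
      using step.hyps(5)[of x] that step.prems kj by (auto simp: down_interval_def)
    show "j' \<le> kappa L j \<or> j \<le> kappa L j' \<or> j' = j"
      if "j' \<in> join_irr L" "u \<le> kappa L j'" "j' \<le> v" for j'
    proof -
      have j': "j' \<le> m\<^sub>0" "u \<le> m\<^sub>0" using that step.prems step.hyps(1) by auto
      show ?thesis
        using step.hyps(6)[of j'] that kap[of j'] j' kj by (auto simp: join_irr_down_interval)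
    qed
  qed
qed

text \<open>If both endpoints lie on the same side of the prime pair, the induction hypothesis for
  that side is transferred to \<open>L\<close>. Otherwise the prime pair itself splits the interval,
  and each of the two pieces has both endpoints on one side.\<close>

lemma compatibly_dismantlable_splits:
  assumes "compatibly_dismantlable L" "finite_lattice L" "u \<in> L" "v \<in> L" "u \<le> v"
  shows "splits L (join_irr L) (kappa L) u v"
  using assms
proof (induction L arbitrary: u v rule: compatibly_dismantlable.induct)
  case (singleton L)
  then have "u = v" by (auto simp: card_1_singleton_iff)
  then show ?case by (simp add: splits.refl)
next
  case (dismantle L j\<^sub>0 m\<^sub>0)
  let ?U = "up_interval L j\<^sub>0" and ?D = "down_interval L m\<^sub>0"
  have mem: "j\<^sub>0 \<in> L" "m\<^sub>0 \<in> L" using dismantle.hyps(2) by (auto simp: prime_pair_def)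
  have up: "splits L (join_irr L) (kappa L) a b" if "a \<in> L" "b \<in> L" "a \<le> b" "j\<^sub>0 \<le> a" for a b
  proof (rule splits_up_interval[OF _ that(4) dismantle.hyps(4,5)])
    show "splits ?U (join_irr ?U) (kappa ?U) a b"
    proof (rule dismantle.IH(1))
      show "finite_lattice ?U"
        using finite_lattice_up_interval dismantle.prems(1) mem by blast
      show "a \<in> ?U" "b \<in> ?U" "a \<le> b"
        using that by (auto simp: up_interval_def)
    qed
  qed
  \<comment> \<open>Dismantling describes the lower part through inverse pairings on
    meet-irreducibles. Applying it to the mate of \<open>j\<close> and inverting gives the pairing
    itself.\<close>
  have kap: "kappa ?D j = inf m\<^sub>0 (kappa L j)" if j: "j \<in> join_irr L" "j \<le> m\<^sub>0" for j
  proof -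
    have "kappa L j \<in> {m \<in> meet_irr L. kappa_inv L m \<le> m\<^sub>0}"
      using kappa_mem(1)[OF dismantle.hyps(1) j(1)] kappa_inv_kappa[OF dismantle.hyps(1) j(1)] j(2)
      by simp
    then have "inf m\<^sub>0 (kappa L j) \<in> meet_irr ?D" "kappa_inv ?D (inf m\<^sub>0 (kappa L j)) = j"
      using dismantle.hyps(7,8) kappa_inv_kappa[OF dismantle.hyps(1) j(1)]
      by (auto simp: bij_betw_def)
    then show ?thesis
      using kappa_kappa_inv compatibly_dismantlable_uniquely_paired[OF dismantle.hyps(6)] by metis
  qed
  have down: "splits L (join_irr L) (kappa L) a b" if "a \<in> L" "b \<in> L" "a \<le> b" "b \<le> m\<^sub>0" for a b
  proof (rule splits_down_interval[OF _ that(4) kap])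
    show "splits ?D (join_irr ?D) (kappa ?D) a b"
    proof (rule dismantle.IH(2))
      show "finite_lattice ?D"
        using finite_lattice_down_interval dismantle.prems(1) mem by blast
      show "a \<in> ?D" "b \<in> ?D" "a \<le> b"
        using that by (auto simp: down_interval_def)
    qed
  qed
  note pp = dismantle.hyps(2) and fl = dismantle.prems(1)
  note k0 = prime_pair_kappa[OF fl dismantle.hyps(1) pp]
  consider "j\<^sub>0 \<le> u" | "v \<le> m\<^sub>0" | "u \<le> m\<^sub>0" "j\<^sub>0 \<le> v"
    using prime_pair_cases[OF pp] dismantle.prems by blast
  then show ?case
  proof cases
    case 1
    then show ?thesis using up dismantle.prems by blast
  next
    case 2
    then show ?thesis using down dismantle.prems by blast
  next
    case 3
    show ?thesis
    proof (rule splits.step[where j\<^sub>0 = j\<^sub>0])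
      show "u \<le> v" "j\<^sub>0 \<in> join_irr L" "u \<le> kappa L j\<^sub>0" "j\<^sub>0 \<le> v"
        using dismantle.prems prime_pair_join_irr[OF fl pp] 3 k0 by auto
      show "j\<^sub>0 \<le> x \<or> x \<le> kappa L j\<^sub>0" if "x \<in> L" for x
        using prime_pair_cases[OF pp that] k0 by simp
      show "j \<le> kappa L j\<^sub>0 \<or> j\<^sub>0 \<le> kappa L j \<or> j = j\<^sub>0" if "j \<in> join_irr L" for j
        using prime_pair_types[OF fl dismantle.hyps(1) pp that] k0 by simp
      show "splits L (join_irr L) (kappa L) (sup u j\<^sub>0) v"
        using up dismantle.prems 3 mem by (simp add: finite_lattice_sup)
      show "splits L (join_irr L) (kappa L) u (inf v (kappa L j\<^sub>0))"
        using down dismantle.prems 3 mem k0 by (simp add: finite_lattice_inf)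
    qed
  qed
qed

section \<open>Semidistrim lattices\<close>

lemma pverts_undirected: "pverts (undirected_galois_graph L) = join_irr L"
  by (simp add: undirected_galois_graph_def mk_symmetric_def galois_graph_def)

lemma parcs_undirected:
  "(i, j) \<in> parcs (undirected_galois_graph L) \<longleftrightarrow>
    i \<in> join_irr L \<and> j \<in> join_irr L \<and> i \<noteq> j \<and> \<not> (i \<le> kappa L j \<and> j \<le> kappa L i)"
  by (auto simp: undirected_galois_graph_def mk_symmetric_def galois_graph_def)

lemma independent_galois_iff:
  "independent_set (galois_graph L) I \<longleftrightarrow>
    I \<subseteq> join_irr L \<and> (\<forall>i\<in>I. \<forall>j\<in>I. i \<noteq> j \<longrightarrow> i \<le> kappa L j)"
  unfolding independent_set_def galois_graph_def by auto

text \<open>Independence ranges over all ordered pairs, so forgetting orientations does not affect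
  it. Domination is contraposed, which lets non-adjacency enter as inequalities with mates.\<close>

lemma Ind_dom_iff:
  "I \<in> Ind_dom (undirected_galois_graph L) \<longleftrightarrow>
    independent_set (galois_graph L) I \<and>
    (\<forall>j\<in>join_irr L. (\<forall>i\<in>I. i \<le> kappa L j \<and> j \<le> kappa L i) \<longrightarrow> j \<in> I)"
proof -
  have 1: "independent_set (undirected_galois_graph L) I \<longleftrightarrow> independent_set (galois_graph L) I"
    unfolding independent_galois_iff
    by (auto simp: independent_set_def pverts_undirected parcs_undirected)
  have 2: "dominating_set (undirected_galois_graph L) I \<longleftrightarrow>
      (\<forall>j\<in>join_irr L. (\<forall>i\<in>I. i \<le> kappa L j \<and> j \<le> kappa L i) \<longrightarrow> j \<in> I)"
    if "I \<subseteq> join_irr L"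
  proof -
    have "(\<exists>i\<in>I. (j, i) \<in> parcs (undirected_galois_graph L)) \<longleftrightarrow>
        \<not> (\<forall>i\<in>I. i \<le> kappa L j \<and> j \<le> kappa L i)" if "j \<in> join_irr L" "j \<notin> I" for j
      unfolding parcs_undirected using that \<open>I \<subseteq> join_irr L\<close> by (metis subsetD)
    then show ?thesis
      unfolding dominating_set_def pverts_undirected using that by metis
  qed
  show ?thesis
    unfolding Ind_dom_def mem_Collect_eq 1 using 2 by (metis independent_galois_iff)
qed

section \<open>Edge labels of covers\<close>

locale semidistrim_lattice =
  fixes L :: "'a::lattice set"
  assumes finite_lattice: "finite_lattice L" and semidistrim: "semidistrim L"
begin

abbreviation "\<J> \<equiv> join_irr L"
abbreviation "\<kappa> \<equiv> kappa L"
abbreviation "D \<equiv> down_labels L"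
abbreviation "U \<equiv> up_labels L"
abbreviation "Ind \<equiv> {I. independent_set (galois_graph L) I}"

lemma finite_L: "finite L"
  using finite_lattice by (simp add: finite_lattice_def)

lemmas inf_mem = finite_lattice_inf[OF finite_lattice]
  and sup_mem = finite_lattice_sup[OF finite_lattice]

lemma paired: "uniquely_paired L"
  using semidistrim compatibly_dismantlable_uniquely_paired by (auto simp: semidistrim_def)

lemmas not_le_kappa = not_le_kappa[OF paired]
  and kappa_mem = kappa_mem(2)[OF paired]

lemma J_mem: "j \<in> \<J> \<Longrightarrow> j \<in> L"
  by (simp add: join_irr_def)

lemma finite_J: "finite \<J>"
  using finite_L by (rule finite_subset[rotated]) (auto simp: join_irr_def)

lemma interval_splits: "u \<in> L \<Longrightarrow> v \<in> L \<Longrightarrow> u \<le> v \<Longrightarrow> splits L \<J> \<kappa> u v"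
  using compatibly_dismantlable_splits semidistrim finite_lattice unfolding semidistrim_def by blast

lemma D_Ind: "x \<in> L \<Longrightarrow> D x \<in> Ind" and U_Ind: "x \<in> L \<Longrightarrow> U x \<in> Ind"
  using semidistrim by (auto simp: semidistrim_def)

text \<open>A two-element interval splits along some \<open>j\<^sub>0\<close>, and both pieces are
  trivial: \<open>sup x j\<^sub>0 = y\<close> and \<open>inf y (\<kappa> j\<^sub>0) = x\<close>. For
  a label \<open>j\<close>, either of \<open>j \<le> \<kappa> j\<^sub>0\<close> and
  \<open>j\<^sub>0 \<le> \<kappa> j\<close> would then give \<open>j \<le> \<kappa> j\<close>, so
  the trichotomy leaves only \<open>j = j\<^sub>0\<close>.\<close>

lemma ex1_label:
  assumes "covers L x y"
  shows "\<exists>!j. j \<in> M_set L x \<inter> J_set L y"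
proof -
  have mem: "x \<in> L" "y \<in> L" "x < y" using assms by (auto simp: covers_def)
  have "splits L \<J> \<kappa> x y" using mem interval_splits by auto
  then show ?thesis
  proof cases
    case refl
    with mem show ?thesis by simp
  next
    case (step j\<^sub>0)
    have not_x: "\<not> j\<^sub>0 \<le> x" and not_y: "\<not> y \<le> \<kappa> j\<^sub>0"
      using step(2-4) not_le_kappa by (meson order.trans)+
    have s: "sup x j\<^sub>0 = y"
    proof -
      have "sup x j\<^sub>0 \<in> L" "sup x j\<^sub>0 \<le> y" "x < sup x j\<^sub>0"
        using step mem not_x J_mem sup_mem by (auto simp: less_le_not_le)
      with assms show ?thesis by (auto simp: covers_def order.order_iff_strict)
    qed
    have i: "inf y (\<kappa> j\<^sub>0) = x"
    proof -
      have "inf y (\<kappa> j\<^sub>0) \<in> L" "x \<le> inf y (\<kappa> j\<^sub>0)" "inf y (\<kappa> j\<^sub>0) < y"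
        using step mem not_y kappa_mem inf_mem by (auto simp: less_le_not_le)
      with assms show ?thesis by (auto simp: covers_def order.order_iff_strict)
    qed
    show ?thesis
    proof (rule ex1I[of _ j\<^sub>0])
      show "j\<^sub>0 \<in> M_set L x \<inter> J_set L y" using step by (auto simp: M_set_def J_set_def)
      fix j assume "j \<in> M_set L x \<inter> J_set L y"
      then have j: "j \<in> \<J>" "x \<le> \<kappa> j" "j \<le> y" by (auto simp: M_set_def J_set_def)
      have "\<not> j \<le> \<kappa> j\<^sub>0" using i j not_le_kappa by (metis le_inf_iff order.trans)
      moreover have "\<not> j\<^sub>0 \<le> \<kappa> j" using s j not_le_kappa by (metis le_sup_iff order.trans)
      ultimately show "j = j\<^sub>0" using step(6) j by blast
    qed
  qed
qed

lemma edge_label: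
  assumes "covers L x y"
  shows "edge_label L x y \<in> \<J>" "x \<le> \<kappa> (edge_label L x y)" "edge_label L x y \<le> y"
proof -
  have "edge_label L x y \<in> M_set L x \<inter> J_set L y"
    unfolding edge_label_def by (rule theI'[OF ex1_label[OF assms]])
  then show "edge_label L x y \<in> \<J>" "x \<le> \<kappa> (edge_label L x y)" "edge_label L x y \<le> y"
    by (simp_all add: M_set_def J_set_def)
qed

lemma edge_label_eqI:
  "covers L x y \<Longrightarrow> j \<in> \<J> \<Longrightarrow> x \<le> \<kappa> j \<Longrightarrow> j \<le> y \<Longrightarrow> edge_label L x y = j"
  unfolding edge_label_def
  by (rule the1_equality[OF ex1_label]) (simp_all add: M_set_def J_set_def)

text \<open>A label recovers its cover: \<open>inf x (\<kappa> d)\<close> is strictly below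
  \<open>x\<close> and above the covered element, hence equal to it.\<close>

lemma D_E:
  assumes "d \<in> D x"
  obtains y where "covers L y x" "d \<in> \<J>" "y \<le> \<kappa> d" "d \<le> x" "inf x (\<kappa> d) = y"
proof -
  obtain y where y: "covers L y x" "d = edge_label L y x" using assms by (auto simp: down_labels_def)
  note d = edge_label[OF y(1), folded y(2)]
  have n: "\<not> x \<le> \<kappa> d" using d not_le_kappa by (meson order.trans)
  have "inf x (\<kappa> d) \<in> L" "y \<le> inf x (\<kappa> d)" "inf x (\<kappa> d) < x"
    using y d n kappa_mem inf_mem by (auto simp: less_le_not_le covers_def)
  then have "inf x (\<kappa> d) = y" using y(1) by (auto simp: covers_def order.order_iff_strict)
  with y d that show thesis by blast
qed

lemma U_E:
  assumes "d \<in> U x"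
  obtains y where "covers L x y" "d \<in> \<J>" "x \<le> \<kappa> d" "d \<le> y" "sup x d = y"
proof -
  obtain y where y: "covers L x y" "d = edge_label L x y" using assms by (auto simp: up_labels_def)
  note d = edge_label[OF y(1), folded y(2)]
  have n: "\<not> d \<le> x" using d not_le_kappa by (meson order.trans)
  have "sup x d \<in> L" "sup x d \<le> y" "x < sup x d"
    using y d n J_mem sup_mem by (auto simp: less_le_not_le covers_def)
  then have "sup x d = y" using y(1) by (auto simp: covers_def order.order_iff_strict)
  with y d that show thesis by blast
qed

text \<open>The label \<open>d\<close> of a lower cover of \<open>x\<close> above
  \<open>inf x a\<close> works, since \<open>d \<le> a\<close> would give
  \<open>d \<le> inf x a \<le> \<kappa> d\<close>. Such a label certifies that
  \<open>x \<le> a\<close> fails; injectivity of the labelling and the order tests by labels rest on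
  it.\<close>

lemma ex_D_label:
  assumes "a \<in> L" "x \<in> L" "\<not> x \<le> a"
  shows "\<exists>d\<in>D x. inf x a \<le> \<kappa> d \<and> \<not> d \<le> a"
proof -
  have "inf x a < x" "inf x a \<in> L" using assms inf_mem by (auto simp: less_le_not_le)
  then obtain y where y: "covers L y x" "inf x a \<le> y"
    using ex_lower_cover_above finite_L assms by blast
  let ?d = "edge_label L y x"
  have "inf x a \<le> \<kappa> ?d" using edge_label[OF y(1)] y by (meson order.trans)
  moreover from this have "\<not> ?d \<le> a"
    using edge_label[OF y(1)] not_le_kappa by (meson le_inf_iff order.trans)
  ultimately show ?thesis using y(1) by (auto simp: down_labels_def)
qed

lemma ex_U_label:
  assumes "a \<in> L" "x \<in> L" "\<not> a \<le> x"
  shows "\<exists>d\<in>U x. d \<le> sup x a \<and> \<not> a \<le> \<kappa> d"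
proof -
  have "x < sup x a" "sup x a \<in> L" using assms sup_mem by (auto simp: less_le_not_le)
  then obtain y where y: "covers L x y" "y \<le> sup x a"
    using ex_upper_cover_below finite_L assms by blast
  let ?d = "edge_label L x y"
  have "?d \<le> sup x a" using edge_label[OF y(1)] y by (meson order.trans)
  moreover from this have "\<not> a \<le> \<kappa> ?d"
    using edge_label[OF y(1)] not_le_kappa by (meson le_sup_iff order.trans)
  ultimately show ?thesis using y(1) by (auto simp: up_labels_def)
qed

section \<open>Intervals and independent sets\<close>

lemma inj_on_D: "inj_on (\<lambda>x. D x \<inter> M_set L u) {x \<in> L. u \<le> x}"
proof -
  have "x \<le> y" if "x \<in> L" "y \<in> L" "u \<le> x" "u \<le> y" "D x \<inter> M_set L u = D y \<inter> M_set L u" for x y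
  proof (rule ccontr)
    assume "\<not> x \<le> y"
    then obtain d where d: "d \<in> D x" "inf x y \<le> \<kappa> d" "\<not> d \<le> y" using ex_D_label \<open>x \<in> L\<close> \<open>y \<in> L\<close> by blast
    \<comment> \<open>The bound by \<open>u\<close> puts the witness \<open>d\<close> into
      \<open>M_set L u\<close>, so the assumed equality moves it into \<open>D y\<close>, whose
      members lie below \<open>y\<close>.\<close>
    have "u \<le> inf x y" using that by simp
    also have "\<dots> \<le> \<kappa> d" using d(2) .
    finally have "u \<le> \<kappa> d" .
    with d(1) have "d \<in> M_set L u" by (auto simp: M_set_def elim: D_E)
    with d that(5) show False by (auto elim: D_E)
  qed
  then show ?thesis by (intro inj_onI order.antisym) auto
qed

lemma inj_on_U: "inj_on (\<lambda>x. U x \<inter> J_set L v) {x \<in> L. x \<le> v}"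
proof -
  have "x \<le> y" if "x \<in> L" "y \<in> L" "x \<le> v" "y \<le> v" "U x \<inter> J_set L v = U y \<inter> J_set L v" for x y
  proof (rule ccontr)
    assume "\<not> x \<le> y"
    then obtain d where d: "d \<in> U y" "d \<le> sup y x" "\<not> x \<le> \<kappa> d" using ex_U_label \<open>x \<in> L\<close> \<open>y \<in> L\<close> by blast
    have "sup y x \<le> v" using that by simp
    with d(2) have "d \<le> v" by (rule order.trans)
    with d(1) have "d \<in> J_set L v" by (auto simp: J_set_def elim: U_E)
    with d that(5) show False by (auto elim: U_E)
  qed
  then show ?thesis by (intro inj_onI order.antisym) auto
qed

text \<open>If \<open>I\<close> lies below \<open>\<kappa> j\<^sub>0\<close>, the lower piece
  provides \<open>x\<close>. Otherwise the upper piece is used for \<open>I\<close> without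
  \<open>j\<^sub>0\<close>. Enlarging \<open>M_set L (sup u j\<^sub>0)\<close> to
  \<open>M_set L u\<close> can then add only the label \<open>j\<^sub>0\<close>, and it does so
  exactly when \<open>j\<^sub>0\<close> was removed from \<open>I\<close>.\<close>

lemma D_surj:
  assumes "splits L \<J> \<kappa> u v" "u \<in> L" "v \<in> L"
    "I \<in> Ind" "I \<subseteq> M_set L u \<inter> J_set L v"
  shows "\<exists>x\<in>L. u \<le> x \<and> x \<le> v \<and> D x \<inter> M_set L u = I"
  using assms
proof (induction arbitrary: I rule: splits.induct)
  case (refl u)
  have "M_set L u \<inter> J_set L u = {}"
    using not_le_kappa order.trans by (fastforce simp: M_set_def J_set_def)
  moreover have "D u \<subseteq> J_set L u" by (auto simp: J_set_def elim: D_E)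
  ultimately show ?case using refl by blast
next
  case (step u v j\<^sub>0)
  have k0: "\<kappa> j\<^sub>0 \<in> L" and j0: "j\<^sub>0 \<in> L" using step.hyps kappa_mem J_mem by auto
  have indep: "i \<le> \<kappa> j" if "i \<in> I" "j \<in> I" "i \<noteq> j" for i j
    using step.prems(3) that by (auto simp: independent_galois_iff)
  have IV: "i \<in> \<J>" "u \<le> \<kappa> i" "i \<le> v" if "i \<in> I" for i
    using step.prems(4) that by (auto simp: M_set_def J_set_def)
  show ?case
  proof (cases "\<forall>i\<in>I. i \<le> \<kappa> j\<^sub>0")
    case True
    then have "I \<subseteq> M_set L u \<inter> J_set L (inf v (\<kappa> j\<^sub>0))"
      using IV by (auto simp: M_set_def J_set_def)
    then have "\<exists>x\<in>L. u \<le> x \<and> x \<le> inf v (\<kappa> j\<^sub>0) \<and> D x \<inter> M_set L u = I"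
      using step.IH(2) step.prems k0 inf_mem by simp
    then show ?thesis by auto
  next
    case False
    then obtain b where b: "b \<in> I" "\<not> b \<le> \<kappa> j\<^sub>0" by blast
    \<comment> \<open>If this fails, the trichotomy gives \<open>c \<le> \<kappa> j\<^sub>0\<close>,
      so \<open>c\<close> differs from \<open>b\<close> and independence puts \<open>b\<close> below
      \<open>inf v (\<kappa> c)\<close>. That element is not above \<open>j\<^sub>0\<close>, hence
      it is below \<open>\<kappa> j\<^sub>0\<close>, contradicting the choice of
      \<open>b\<close>.\<close>
    have above: "j\<^sub>0 \<le> \<kappa> c" if c: "c \<in> I" "c \<noteq> j\<^sub>0" for c
    proof (rule ccontr)
      assume neg: "\<not> j\<^sub>0 \<le> \<kappa> c"
      have "b \<noteq> c" using step.hyps(6)[of c] IV c b neg by auto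
      then have "b \<le> inf v (\<kappa> c)" using indep b c IV by auto
      moreover have "inf v (\<kappa> c) \<le> \<kappa> j\<^sub>0"
        using step.hyps(5)[of "inf v (\<kappa> c)"] step.prems step.hyps(1) IV[OF c(1)] kappa_mem inf_mem neg
        by auto
      ultimately show False using b by (meson order.trans)
    qed
    define I' where "I' = I - {j\<^sub>0}"
    have "I' \<subseteq> M_set L (sup u j\<^sub>0) \<inter> J_set L v"
      using IV above by (auto simp: M_set_def J_set_def I'_def)
    moreover have "I' \<in> Ind" using step.prems(3) by (auto simp: independent_galois_iff I'_def)
    ultimately obtain x where x: "x \<in> L" "sup u j\<^sub>0 \<le> x" "x \<le> v" "D x \<inter> M_set L (sup u j\<^sub>0) = I'"
      using step.IH(1)[of I'] step.prems j0 sup_mem by blast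
    \<comment> \<open>Otherwise the lower cover \<open>y\<close> belonging to \<open>d\<close> is
      not above \<open>j\<^sub>0\<close>, so \<open>y \<le> \<kappa> j\<^sub>0\<close>. Then
      \<open>j\<^sub>0\<close> labels the same cover, and uniqueness of labels gives
      \<open>d = j\<^sub>0\<close>.\<close>
    have "j\<^sub>0 \<le> \<kappa> d" if d: "d \<in> D x" "d \<in> M_set L u" "d \<noteq> j\<^sub>0" for d
    proof (rule ccontr)
      assume neg: "\<not> j\<^sub>0 \<le> \<kappa> d"
      obtain y where y: "covers L y x" "d \<in> \<J>" "y \<le> \<kappa> d" "d \<le> x" "inf x (\<kappa> d) = y"
        using d(1) D_E by blast
      have "u \<le> y" using x(2) y(5) d(2) by (auto simp: M_set_def)
      then have "y \<le> \<kappa> j\<^sub>0"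
        using step.hyps(5)[of y] y x neg by (auto simp: covers_def)
      then have "edge_label L y x = j\<^sub>0" using edge_label_eqI y(1) step.hyps x by auto
      moreover have "edge_label L y x = d" using edge_label_eqI y by auto
      ultimately show False using d by simp
    qed
    then have Dx: "D x \<inter> M_set L u - {j\<^sub>0} = I'"
      using x(4) by (auto simp: M_set_def I'_def)
    have "j\<^sub>0 \<in> D x \<longleftrightarrow> j\<^sub>0 \<in> I"
    proof
      assume "j\<^sub>0 \<in> D x"
      show "j\<^sub>0 \<in> I"
      proof (rule ccontr)
        assume "j\<^sub>0 \<notin> I"
        \<comment> \<open>Here \<open>b\<close> and \<open>j\<^sub>0\<close> would both be labels of
          \<open>x\<close>, while \<open>b\<close> is not below \<open>\<kappa> j\<^sub>0\<close>;
          this contradicts independence of \<open>D x\<close>.\<close>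
        then have "b \<in> D x" "b \<noteq> j\<^sub>0" using b Dx by (auto simp: I'_def)
        then show False
          using D_Ind[OF x(1)] \<open>j\<^sub>0 \<in> D x\<close> b by (auto simp: independent_galois_iff)
      qed
    next
      assume "j\<^sub>0 \<in> I"
      show "j\<^sub>0 \<in> D x"
      proof (rule ccontr)
        assume nin: "j\<^sub>0 \<notin> D x"
        \<comment> \<open>This yields a label \<open>d\<close> of \<open>x\<close> not below
          \<open>\<kappa> j\<^sub>0\<close>. If \<open>j\<^sub>0\<close> is not a label,
          \<open>d\<close> is another element of \<open>I\<close>, against independence of
          \<open>I\<close>.\<close>
        have "\<not> x \<le> \<kappa> j\<^sub>0" using x(2) not_le_kappa step.hyps(2) by (meson le_sup_iff order.trans)
        then obtain d where d: "d \<in> D x" "inf x (\<kappa> j\<^sub>0) \<le> \<kappa> d" "\<not> d \<le> \<kappa> j\<^sub>0"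
          using ex_D_label[OF k0 x(1)] by blast
        have "u \<le> inf x (\<kappa> j\<^sub>0)" using x(2) step.hyps(3) by simp
        also have "\<dots> \<le> \<kappa> d" using d(2) .
        finally have "u \<le> \<kappa> d" .
        with d(1) have "d \<in> M_set L u" by (auto simp: M_set_def elim: D_E)
        then have "d \<in> I" "d \<noteq> j\<^sub>0" using d nin Dx by (auto simp: I'_def)
        then show False using indep \<open>j\<^sub>0 \<in> I\<close> d by blast
      qed
    qed
    then have "D x \<inter> M_set L u = I"
      using Dx step.hyps(2,3) by (auto simp: I'_def M_set_def)
    with x show ?thesis by auto
  qed
qed

lemma bij_D:
  assumes "u \<in> L" "v \<in> L" "u \<le> v"
  shows "bij_betw (\<lambda>x. D x \<inter> M_set L u) {x \<in> L. u \<le> x \<and> x \<le> v}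
    {I \<in> Ind. I \<subseteq> M_set L u \<inter> J_set L v}"
proof (rule bij_betw_imageI)
  show "inj_on (\<lambda>x. D x \<inter> M_set L u) {x \<in> L. u \<le> x \<and> x \<le> v}"
    using inj_on_D by (rule inj_on_subset) auto
  have "D x \<inter> M_set L u \<in> {I \<in> Ind. I \<subseteq> M_set L u \<inter> J_set L v}" if "x \<in> L" "x \<le> v" for x
  proof -
    have "D x \<subseteq> J_set L v" using that by (auto simp: J_set_def elim!: D_E)
    moreover have "D x \<inter> M_set L u \<in> Ind"
      using D_Ind[OF that(1)] by (auto simp: independent_galois_iff)
    ultimately show ?thesis by auto
  qed
  moreover have "\<exists>x\<in>{x \<in> L. u \<le> x \<and> x \<le> v}. I = D x \<inter> M_set L u"
    if "I \<in> {I \<in> Ind. I \<subseteq> M_set L u \<inter> J_set L v}" for I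
    using D_surj[OF interval_splits[OF assms] assms(1,2), of I] that by blast
  ultimately show "(\<lambda>x. D x \<inter> M_set L u) ` {x \<in> L. u \<le> x \<and> x \<le> v} =
    {I \<in> Ind. I \<subseteq> M_set L u \<inter> J_set L v}"
    by blast
qed

text \<open>Injectivity into a set which \<open>bij_D\<close> shows to have as many elements as the interval
  replaces a dual of \<open>D_surj\<close>.\<close>

lemma bij_U:
  assumes "u \<in> L" "v \<in> L" "u \<le> v"
  shows "bij_betw (\<lambda>x. U x \<inter> J_set L v) {x \<in> L. u \<le> x \<and> x \<le> v}
    {I \<in> Ind. I \<subseteq> M_set L u \<inter> J_set L v}" (is "bij_betw ?f ?A ?B")
proof (rule bij_betw_imageI)
  show inj: "inj_on ?f ?A"
    using inj_on_U by (rule inj_on_subset) auto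
  have "?f x \<in> ?B" if "x \<in> L" "u \<le> x" for x
  proof -
    have "U x \<subseteq> M_set L u" using that by (auto simp: M_set_def elim!: U_E)
    moreover have "?f x \<in> Ind"
      using U_Ind[OF that(1)] by (auto simp: independent_galois_iff)
    ultimately show ?thesis by auto
  qed
  then have "?f ` ?A \<subseteq> ?B" by auto
  moreover have "finite ?B"
    using finite_J by (rule finite_subset[rotated, OF finite_Pow_iff[THEN iffD2]])
      (auto simp: independent_galois_iff)
  moreover have "card (?f ` ?A) = card ?B"
    using card_image[OF inj] bij_betw_same_card[OF bij_D[OF assms]] by simp
  ultimately show "?f ` ?A = ?B" by (intro card_subset_eq)
qed

text \<open>This is the interval statement from bottom to top. There \<open>M_set\<close> of the
  bottom and \<open>J_set\<close> of the top contain all join-irreducibles, so the restrictions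
  disappear.\<close>

lemma bij_betw_D: "bij_betw D L Ind" and bij_betw_U: "bij_betw U L Ind"
proof -
  have "L \<noteq> {}" using finite_lattice by (simp add: finite_lattice_def)
  define bot top where "bot = Inf_fin L" and "top = Sup_fin L"
  have bt: "bot \<in> L" "top \<in> L"
    unfolding bot_def top_def
    using finite_lattice \<open>L \<noteq> {}\<close> finite_lattice_Inf_fin finite_lattice_Sup_fin by blast+
  have le: "bot \<le> x" "x \<le> top" if "x \<in> L" for x
    unfolding bot_def top_def using finite_L that by (auto intro: Inf_fin.coboundedI Sup_fin.coboundedI)
  have "M_set L bot = \<J>" "J_set L top = \<J>"
    using le kappa_mem J_mem by (auto simp: M_set_def J_set_def)
  moreover have "{x \<in> L. bot \<le> x \<and> x \<le> top} = L" using le by auto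
  moreover have "{I \<in> Ind. I \<subseteq> \<J>} = Ind" by (auto simp: independent_galois_iff)
  moreover have "D x \<inter> \<J> = D x" "U x \<inter> \<J> = U x" for x by (auto elim: D_E U_E)
  ultimately show "bij_betw D L Ind" "bij_betw U L Ind"
    using bij_D[OF bt le(1)[OF bt(2)]] bij_U[OF bt le(1)[OF bt(2)]] by simp_all
qed

section \<open>Pop operators and order in terms of labels\<close>

lemma finite_covers: "finite {y. covers L y x}" "finite {y. covers L x y}"
  using finite_L by (auto simp: covers_def)

lemma le_Pop_down_iff:
  "w \<le> Pop_down L x \<longleftrightarrow> w \<le> x \<and> (\<forall>y. covers L y x \<longrightarrow> w \<le> y)"
  unfolding Pop_down_def using finite_covers by (subst Inf_fin.bounded_iff) auto

lemma Pop_up_le_iff: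
  "Pop_up L x \<le> w \<longleftrightarrow> x \<le> w \<and> (\<forall>y. covers L x y \<longrightarrow> y \<le> w)"
  unfolding Pop_up_def using finite_covers by (subst Sup_fin.bounded_iff) auto

lemma Pop_down_mem: "x \<in> L \<Longrightarrow> Pop_down L x \<in> L"
  unfolding Pop_down_def by (rule finite_lattice_Inf_fin[OF finite_lattice]) (auto simp: covers_def)

lemma Pop_up_mem: "x \<in> L \<Longrightarrow> Pop_up L x \<in> L"
  unfolding Pop_up_def by (rule finite_lattice_Sup_fin[OF finite_lattice]) (auto simp: covers_def)

text \<open>Every lower cover of \<open>x\<close> has the form \<open>inf x (\<kappa> d)\<close> for
  its label \<open>d\<close>, so below \<open>x\<close> the lower covers and the mates of the labels
  impose the same bounds.\<close>

lemma Pop_down_labels_iff: "w \<le> Pop_down L x \<longleftrightarrow> w \<le> x \<and> (\<forall>d\<in>D x. w \<le> \<kappa> d)"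
proof
  assume "w \<le> Pop_down L x"
  then show "w \<le> x \<and> (\<forall>d\<in>D x. w \<le> \<kappa> d)"
    unfolding le_Pop_down_iff by (auto elim!: D_E)
next
  assume w: "w \<le> x \<and> (\<forall>d\<in>D x. w \<le> \<kappa> d)"
  have "w \<le> y" if y: "covers L y x" for y
  proof -
    have d: "edge_label L y x \<in> D x" using y by (auto simp: down_labels_def)
    then obtain y' where "covers L y' x" "inf x (\<kappa> (edge_label L y x)) = y'" by (rule D_E)
    moreover have "y \<le> inf x (\<kappa> (edge_label L y x))"
      using edge_label[OF y] y by (auto simp: covers_def)
    ultimately have "inf x (\<kappa> (edge_label L y x)) = y"
      using y by (auto simp: covers_def order.order_iff_strict)
    with w d show ?thesis by (metis le_inf_iff)
  qed
  with w show "w \<le> Pop_down L x" unfolding le_Pop_down_iff by blast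
qed

lemma Pop_up_labels_iff: "Pop_up L x \<le> w \<longleftrightarrow> x \<le> w \<and> (\<forall>d\<in>U x. d \<le> w)"
proof
  assume "Pop_up L x \<le> w"
  then show "x \<le> w \<and> (\<forall>d\<in>U x. d \<le> w)"
    unfolding Pop_up_le_iff by (auto elim!: U_E)
next
  assume w: "x \<le> w \<and> (\<forall>d\<in>U x. d \<le> w)"
  have "y \<le> w" if y: "covers L x y" for y
  proof -
    have d: "edge_label L x y \<in> U x" using y by (auto simp: up_labels_def)
    then obtain y' where "covers L x y'" "sup x (edge_label L x y) = y'" by (rule U_E)
    moreover have "sup x (edge_label L x y) \<le> y"
      using edge_label[OF y] y by (auto simp: covers_def)
    ultimately have "sup x (edge_label L x y) = y"
      using y by (auto simp: covers_def order.order_iff_strict)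
    with w d show ?thesis by (metis le_sup_iff)
  qed
  with w show "Pop_up L x \<le> w" unfolding Pop_up_le_iff by blast
qed

text \<open>In order-theoretic form, \<open>x\<close> is the join of its down-labels: if
  \<open>x \<le> a\<close> fails, some label already fails to lie below \<open>a\<close>.\<close>

lemma le_iff_D:
  assumes "x \<in> L" "a \<in> L"
  shows "x \<le> a \<longleftrightarrow> (\<forall>d\<in>D x. d \<le> a)"
proof
  show "\<forall>d\<in>D x. d \<le> a" if "x \<le> a" using that by (auto elim!: D_E)
  show "x \<le> a" if "\<forall>d\<in>D x. d \<le> a" using that ex_D_label[OF assms(2,1)] by blast
qed

text \<open>Dually, \<open>x\<close> is the meet of the mates of its up-labels.\<close>

lemma le_iff_U:
  assumes "x \<in> L" "a \<in> L"
  shows "a \<le> x \<longleftrightarrow> (\<forall>d\<in>U x. a \<le> \<kappa> d)"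
proof
  show "\<forall>d\<in>U x. a \<le> \<kappa> d" if "a \<le> x" using that by (auto elim!: U_E)
  show "a \<le> x" if "\<forall>d\<in>U x. a \<le> \<kappa> d" using that ex_U_label[OF assms(2,1)] by blast
qed

text \<open>In the interval between \<open>Pop_down L x\<close> and \<open>x\<close>, the element with up-labels \<open>D x\<close> lies
  below all lower covers of \<open>x\<close>, so it is the bottom.\<close>

lemma D_subset_U_Pop_down:
  assumes "x \<in> L"
  shows "D x \<subseteq> U (Pop_down L x)"
proof -
  let ?z = "Pop_down L x"
  have z: "?z \<in> L" "?z \<le> x" "\<forall>d\<in>D x. ?z \<le> \<kappa> d"
    using Pop_down_mem[OF assms] Pop_down_labels_iff[of ?z x] by auto
  have "D x \<subseteq> M_set L ?z \<inter> J_set L x" using z by (auto simp: M_set_def J_set_def elim: D_E)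
  then have "D x \<in> {I \<in> Ind. I \<subseteq> M_set L ?z \<inter> J_set L x}" using D_Ind[OF assms] by blast
  then have "D x \<in> (\<lambda>w. U w \<inter> J_set L x) ` {w \<in> L. ?z \<le> w \<and> w \<le> x}"
    unfolding bij_betw_imp_surj_on[OF bij_U[OF z(1) assms z(2)]] .
  then obtain w where w: "w \<in> L" "?z \<le> w" "w \<le> x" "D x = U w \<inter> J_set L x"
    by auto
  then have "\<forall>d\<in>D x. w \<le> \<kappa> d" by (auto elim: U_E)
  then have "w = ?z" using w Pop_down_labels_iff by (intro order.antisym) auto
  with w show ?thesis by blast
qed

text \<open>Some \<open>w\<close> between \<open>x\<close> and \<open>Pop_up L x\<close> has
  \<open>U x\<close> as its down-labels in \<open>M_set L x\<close>. It lies above all these labels,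
  hence above \<open>Pop_up L x\<close>.\<close>

lemma U_subset_D_Pop_up:
  assumes "x \<in> L"
  shows "U x \<subseteq> D (Pop_up L x)"
proof -
  let ?z = "Pop_up L x"
  have z: "?z \<in> L" "x \<le> ?z" "\<forall>d\<in>U x. d \<le> ?z"
    using Pop_up_mem[OF assms] Pop_up_labels_iff[of x ?z] by auto
  have "U x \<subseteq> M_set L x \<inter> J_set L ?z" using z by (auto simp: M_set_def J_set_def elim: U_E)
  then have "U x \<in> {I \<in> Ind. I \<subseteq> M_set L x \<inter> J_set L ?z}" using U_Ind[OF assms] by blast
  then have "U x \<in> (\<lambda>w. D w \<inter> M_set L x) ` {w \<in> L. x \<le> w \<and> w \<le> ?z}"
    unfolding bij_betw_imp_surj_on[OF bij_D[OF assms z(1) z(2)]] .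
  then obtain w where w: "w \<in> L" "x \<le> w" "w \<le> ?z" "U x = D w \<inter> M_set L x"
    by auto
  then have "\<forall>d\<in>U x. d \<le> w" by (auto elim: D_E)
  then have "w = ?z" using w Pop_up_labels_iff by (intro order.antisym) auto
  with w show ?thesis by blast
qed

section \<open>Rowmotion\<close>

lemma Row_mem: "x \<in> L \<Longrightarrow> Row L x \<in> L"
  and U_Row: "x \<in> L \<Longrightarrow> U (Row L x) = D x"
  unfolding Row_def using bij_betw_U D_Ind
  by (auto simp: bij_betw_def intro!: the_inv_into_into f_the_inv_into_f)

lemma Row_surj:
  assumes "z \<in> L"
  obtains x where "x \<in> L" "Row L x = z" "D x = U z"
proof -
  obtain x where x: "x \<in> L" "D x = U z"
    using U_Ind[OF assms] bij_betw_imp_surj_on[OF bij_betw_D] by (metis imageE)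
  then have "Row L x = z"
    using U_Row Row_mem assms bij_betw_imp_inj_on[OF bij_betw_U] by (metis inj_onD)
  with x that show thesis by blast
qed

text \<open>Because \<open>Row L x\<close> has up-labels \<open>D x\<close>, lying below it means
  lying below all mates of \<open>D x\<close>, which is what \<open>Pop_down L x\<close> demands of
  elements below \<open>x\<close>.\<close>

lemma Pop_down_eq:
  assumes "x \<in> L"
  shows "Pop_down L x = inf x (Row L x)"
proof -
  have "w \<le> Pop_down L x \<longleftrightarrow> w \<le> inf x (Row L x)" if "w \<in> L" for w
    unfolding Pop_down_labels_iff le_inf_iff le_iff_U[OF Row_mem[OF assms] that] U_Row[OF assms] ..
  from this[OF Pop_down_mem[OF assms]] this[OF inf_mem[OF assms Row_mem[OF assms]]]
  show ?thesis by (simp add: order.antisym)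
qed

lemma Pop_up_Row_eq:
  assumes "x \<in> L"
  shows "Pop_up L (Row L x) = sup x (Row L x)"
proof -
  have "Pop_up L (Row L x) \<le> w \<longleftrightarrow> sup x (Row L x) \<le> w" if "w \<in> L" for w
    unfolding Pop_up_labels_iff le_sup_iff le_iff_D[OF assms that] U_Row[OF assms] by blast
  from this[OF Pop_up_mem[OF Row_mem[OF assms]]] this[OF sup_mem[OF assms Row_mem[OF assms]]]
  show ?thesis by (simp add: order.antisym)
qed

section \<open>Independent dominating sets and images of the Pop operators\<close>

abbreviation "Dom \<equiv> Ind_dom (undirected_galois_graph L)"

text \<open>An element of \<open>K\<close> outside \<open>I\<close> would be adjacent to nothing in
  \<open>I\<close> because \<open>K\<close> is independent, so domination would put it into
  \<open>I\<close>.\<close>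

lemma Dom_maximal: "I \<in> Dom \<Longrightarrow> I \<subseteq> K \<Longrightarrow> K \<in> Ind \<Longrightarrow> K = I"
proof -
  assume I: "I \<in> Dom" "I \<subseteq> K" and K: "K \<in> Ind"
  have "j \<in> I" if j: "j \<in> K" for j
  proof (rule ccontr)
    assume "j \<notin> I"
    have "i \<le> \<kappa> j \<and> j \<le> \<kappa> i" if "i \<in> I" for i
    proof -
      have "i \<in> K" "i \<noteq> j" using I(2) that \<open>j \<notin> I\<close> by blast+
      then show ?thesis using j K by (simp add: independent_galois_iff)
    qed
    moreover have "j \<in> \<J>" using j K by (auto simp: independent_galois_iff)
    ultimately have "\<forall>i\<in>I. i \<le> \<kappa> j \<and> j \<le> \<kappa> i" "j \<in> \<J>" by simp_all
    with \<open>j \<notin> I\<close> I(1) show False by (simp add: Ind_dom_iff)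
  qed
  with I(2) show "K = I" by blast
qed

lemma Row_le_iff:
  assumes "x \<in> L"
  shows "Row L x \<le> x \<longleftrightarrow> D x \<in> Dom"
proof
  assume le: "Row L x \<le> x"
  \<comment> \<open>The assumption on \<open>j\<close> is contradictory: non-adjacency on one side
    gives \<open>x \<le> \<kappa> j\<close>, on the other \<open>j \<le> Row L x\<close>, and with
    \<open>Row L x \<le> x\<close> this yields \<open>j \<le> \<kappa> j\<close>.\<close>
  have "j \<in> D x" if j: "j \<in> \<J>" "\<forall>i\<in>D x. i \<le> \<kappa> j \<and> j \<le> \<kappa> i" for j
  proof -
    have "x \<le> \<kappa> j" using le_iff_D[OF assms kappa_mem] j by blast
    moreover have "j \<le> Row L x"
      using le_iff_U[OF Row_mem[OF assms] J_mem] U_Row[OF assms] j by blast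
    ultimately show ?thesis using not_le_kappa j le by (meson order.trans)
  qed
  then show "D x \<in> Dom" using D_Ind[OF assms] by (auto simp: Ind_dom_iff)
next
  assume "D x \<in> Dom"
  \<comment> \<open>A dominating \<open>D x\<close> is a maximal independent set, so its inclusion
    in the up-labels of \<open>Pop_down L x\<close> is an equality.\<close>
  then have "U (Pop_down L x) = D x"
    using Dom_maximal D_subset_U_Pop_down U_Ind Pop_down_mem assms by blast
  then have "Pop_down L x = Row L x"
    using U_Row Row_mem Pop_down_mem assms bij_betw_imp_inj_on[OF bij_betw_U] by (metis inj_onD)
  then show "Row L x \<le> x" using Pop_down_eq[OF assms] by (metis inf_le1)
qed

text \<open>For \<open>z = Pop_down L x\<close>, the inclusion of \<open>D x\<close> in
  \<open>U z\<close> lets non-adjacency to \<open>U z\<close> bound both \<open>x\<close> and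
  \<open>z\<close>, as for rowmotion. Conversely, if \<open>U z\<close> dominates, the rowmotion
  preimage \<open>x\<close> of \<open>z\<close> lies above \<open>z\<close>, so
  \<open>Pop_down L x = inf x z = z\<close>.\<close>

lemma Pop_down_image: "Pop_down L ` L = {z \<in> L. U z \<in> Dom}"
proof (intro equalityI subsetI)
  fix z assume "z \<in> Pop_down L ` L"
  then obtain x where x: "x \<in> L" "z = Pop_down L x" by blast
  then have z: "z \<in> L" "z \<le> x" using Pop_down_mem Pop_down_eq by auto
  have "j \<in> U z" if j: "j \<in> \<J>" "\<forall>i\<in>U z. i \<le> \<kappa> j \<and> j \<le> \<kappa> i" for j
  proof -
    have "x \<le> \<kappa> j"
      using le_iff_D[OF x(1) kappa_mem] j D_subset_U_Pop_down[OF x(1)] x(2) by blast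
    moreover have "j \<le> z" using le_iff_U[OF z(1) J_mem] j by blast
    ultimately show ?thesis using not_le_kappa j z(2) by (meson order.trans)
  qed
  then show "z \<in> {z \<in> L. U z \<in> Dom}" using z U_Ind by (auto simp: Ind_dom_iff)
next
  fix z assume z: "z \<in> {z \<in> L. U z \<in> Dom}"
  then obtain x where x: "x \<in> L" "Row L x = z" "D x = U z" using Row_surj by blast
  then have "z \<le> x" using Row_le_iff[OF x(1)] z by auto
  then have "Pop_down L x = z" using Pop_down_eq[OF x(1)] x(2) by (simp add: inf_absorb2)
  with x(1) show "z \<in> Pop_down L ` L" by (metis imageI)
qed

text \<open>The converse inclusion uses \<open>Row L x\<close> as preimage of \<open>x\<close>: when
  \<open>D x\<close> dominates, \<open>sup x (Row L x)\<close> collapses to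
  \<open>x\<close>.\<close>

lemma Pop_up_image: "Pop_up L ` L = {x \<in> L. D x \<in> Dom}"
proof (intro equalityI subsetI)
  fix x assume "x \<in> Pop_up L ` L"
  then obtain z where z: "z \<in> L" "x = Pop_up L z" by blast
  then have x: "x \<in> L" "z \<le> x" using Pop_up_mem Pop_up_labels_iff[of z x] by auto
  have "j \<in> D x" if j: "j \<in> \<J>" "\<forall>i\<in>D x. i \<le> \<kappa> j \<and> j \<le> \<kappa> i" for j
  proof -
    have "j \<le> z"
      using le_iff_U[OF z(1) J_mem] j U_subset_D_Pop_up[OF z(1)] z(2) by blast
    moreover have "x \<le> \<kappa> j" using le_iff_D[OF x(1) kappa_mem] j by blast
    ultimately show ?thesis using not_le_kappa j x(2) by (meson order.trans)
  qed
  then show "x \<in> {x \<in> L. D x \<in> Dom}" using x D_Ind by (auto simp: Ind_dom_iff)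
next
  fix x assume x: "x \<in> {x \<in> L. D x \<in> Dom}"
  then have "Row L x \<le> x" using Row_le_iff by blast
  then have "Pop_up L (Row L x) = x" using Pop_up_Row_eq x by (simp add: sup_absorb1)
  with x Row_mem show "x \<in> Pop_up L ` L" by (metis (lifting) image_eqI mem_Collect_eq)
qed

lemma card_preimage_Dom:
  assumes "bij_betw f L Ind"
  shows "card {x \<in> L. f x \<in> Dom} = card Dom"
proof -
  have "Dom \<subseteq> Ind" by (auto simp: Ind_dom_iff)
  then have "Dom \<subseteq> f ` L" using assms by (simp add: bij_betw_def)
  then have "f ` {x \<in> L. f x \<in> Dom} = Dom" by (auto simp: subset_iff image_iff)
  moreover have "inj_on f {x \<in> L. f x \<in> Dom}"
    using assms by (auto simp: bij_betw_def intro: inj_on_subset)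
  ultimately show ?thesis by (metis card_image)
qed

end

theorem theorem9p13:
  fixes L :: "'a::lattice set"
  assumes "finite_lattice L" and "semidistrim L"
  shows "(\<forall>x\<in>L. Row L x \<le> x \<longleftrightarrow> down_labels L x \<in> Ind_dom (undirected_galois_graph L)) \<and>
    card {x \<in> L. Row L x \<le> x} = card (Pop_down L ` L) \<and>
    card (Pop_down L ` L) = card (Pop_up L ` L) \<and>
    card (Pop_up L ` L) = card (Ind_dom (undirected_galois_graph L))"
proof -
  interpret semidistrim_lattice L using assms by unfold_locales
  have "{x \<in> L. Row L x \<le> x} = {x \<in> L. D x \<in> Dom}" using Row_le_iff by blast
  \<comment> \<open>The bijection \<open>D\<close> counts both the rowmotion set and the image of
    \<open>Pop_up\<close>, while \<open>U\<close> counts the image of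
    \<open>Pop_down\<close>.\<close>
  then show ?thesis
    using Row_le_iff Pop_down_image Pop_up_image
      card_preimage_Dom[OF bij_betw_D] card_preimage_Dom[OF bij_betw_U] by simp
qed

end
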